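(* Let $n,N\ge 1$, let $\alpha>0$, and let $L=(L_1,\dots,L_N)\in\mathcal H^N$ be such that $\ker(\nabla_L)$ contains only scalar multiples of the identity matrix. Then the formula $$V_1(\rho_0,\rho_1)=\inf_{u\in\mathcal S^N,\ v\in\mathcal H}\left\{\|u\|_*+\alpha\|v\|_*\ \mid\ \rho_0-\rho_1-\nabla_L^*u-v=0\right\},\qquad \rho_0,\rho_1\in\mathcal H_+,$$ defines a metric on $\mathcal H_+$.
   Context: All matrices are complex. $\mathcal H$ and $\mathcal S$ denote the sets of $n\times n$ Hermitian and skew-Hermitian matrices, respectively. $\mathcal H^N$ and $\mathcal S^N$ denote the spaces of block-column vectors with $N$ blocks in $\mathcal H$, respectively $\mathcal S$ (so such an element is an $nN\times n$ matrix). $\mathcal H_+\subset\mathcal H$ is the cone of positive semidefinite matrices. The inner product on $\mathcal H$ and $\mathcal S$ is $\langle X,Y\rangle=\operatorname{tr}(X^*Y)$, and on $\mathcal H^N$ and $\mathcal S^N$ it is $\langle X,Y\rangle=\sum_{k=1}^N\operatorname{tr}(X_k^*Y_k)$. For $L\in\mathcal H^N$, the gradient operator $\nabla_L:\mathcal H\to\mathcal S^N$ sends $X$ to the block-column with $k$-th block $L_kX-XL_k$. Its adjoint with respect to the inner products $\langle X,Y\rangle=\operatorname{tr}(X^*Y)$ on $\mathcal H$ and $\langle X,Y\rangle=\sum_{k=1}^N\operatorname{tr}(X_k^*Y_k)$ on $\mathcal S^N$ is $\nabla_L^*:\mathcal S^N\to\mathcal H$, $\nabla_L^*Y=\sum_{k=1}^N(L_kY_k-Y_kL_k)$.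 $\|\cdot\|_*$ is the nuclear norm (sum of singular values), of an $n\times n$ matrix or of a block-column viewed as an $nN\times n$ matrix. *)

theory Defs
  imports "HOL-Analysis.Analysis" "HOL-Computational_Algebra.Polynomial"
begin

definition ctranspose :: "complex^'n^'m \<Rightarrow> complex^'m^'n" where
  "ctranspose A = (\<chi> i j. cnj (A $ j $ i))"

definition herm_mats :: "(complex^'n^'n) set" where
  "herm_mats = {A. ctranspose A = A}"

definition skew_herm_mats :: "(complex^'n^'n) set" where
  "skew_herm_mats = {A. ctranspose A = - A}"

definition psd_mats :: "(complex^'n^'n) set" where
  "psd_mats = {A \<in> herm_mats. \<forall>x. 0 \<le> Re (\<Sum>i\<in>UNIV. cnj (x $ i) * (A *v x) $ i)}"

(* A block-column with blocks indexed by the finite type 'b is an element of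
   complex^'n^'n^'b. *)

definition herm_cols :: "(complex^'n^'n^'b) set" where
  "herm_cols = {X. \<forall>k. X $ k \<in> herm_mats}"

definition skew_herm_cols :: "(complex^'n^'n^'b) set" where
  "skew_herm_cols = {Y. \<forall>k. Y $ k \<in> skew_herm_mats}"

(* The block-column as one tall matrix; row i of block k has the index (k, i). *)
definition stack :: "complex^'n^'n^'b \<Rightarrow> complex^'n^('b \<times> 'n)" where
  "stack u = (\<chi> r. u $ fst r $ snd r)"

definition charpoly :: "complex^'n^'n \<Rightarrow> complex poly" where
  "charpoly A = det (\<chi> i j. (if i = j then [:0, 1:] else 0) - [:A $ i $ j:])"

(* The singular values with multiplicity are the square roots of the eigenvalues of
   A* A, one for each column of A. If A has fewer rows than columns, this only adds
   zeros to the usual list. The eigenvalues are real and nonnegative. *)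
definition singular_values :: "complex^'n^'m \<Rightarrow> real multiset" where
  "singular_values A =
     image_mset (\<lambda>z. sqrt (Re z)) (proots (charpoly (ctranspose A ** A)))"

definition nuclear_norm :: "complex^'n^'m \<Rightarrow> real" where
  "nuclear_norm A = sum_mset (singular_values A)"

definition grad :: "complex^'n^'n^'b \<Rightarrow> complex^'n^'n \<Rightarrow> complex^'n^'n^'b" where
  "grad L X = (\<chi> k. L $ k ** X - X ** L $ k)"

definition grad_adj :: "complex^'n^'n^'b \<Rightarrow> complex^'n^'n^'b \<Rightarrow> complex^'n^'n" where
  "grad_adj L Y = (\<Sum>k\<in>UNIV. L $ k ** Y $ k - Y $ k ** L $ k)"

definition V1_feasible ::
  "complex^'n^'n^'b \<Rightarrow> complex^'n^'n \<Rightarrow> complex^'n^'n \<Rightarrow> ((complex^'n^'n^'b) \<times> (complex^'n^'n)) set" where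
  "V1_feasible L \<rho>0 \<rho>1 =
     {(u, v). u \<in> skew_herm_cols \<and> v \<in> herm_mats \<and> \<rho>0 - \<rho>1 - grad_adj L u - v = 0}"

(* A function on pairs of positive semidefinite matrices. The value 0 elsewhere is a
   dummy: Metric_space asks for nonnegativity and symmetry off the carrier too. *)
definition V1 ::
  "real \<Rightarrow> complex^'n^'n^'b \<Rightarrow> complex^'n^'n \<Rightarrow> complex^'n^'n \<Rightarrow> real" where
  "V1 \<alpha> L \<rho>0 \<rho>1 =
     (if \<rho>0 \<in> psd_mats \<and> \<rho>1 \<in> psd_mats
      then (INF (u, v) \<in> V1_feasible L \<rho>0 \<rho>1. nuclear_norm (stack u) + \<alpha> * nuclear_norm v)
      else 0)"

lemma trace_diff: "trace (A - B) = trace A - trace (B :: complex^'n^'n)"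
  by (simp add: trace_def sum_subtractf)

lemma trace_sum: "trace (\<Sum>k\<in>K. f k) = (\<Sum>k\<in>K. trace (f k :: complex^'n^'n))"
  by (simp add: trace_def) (rule sum.swap)

lemma ctranspose_mult: "ctranspose (A ** B) = ctranspose B ** ctranspose A"
  by (simp add: ctranspose_def matrix_matrix_mult_def vec_eq_iff mult.commute)

lemma ctranspose_diff: "ctranspose (A - B) = ctranspose A - ctranspose B"
  by (simp add: ctranspose_def vec_eq_iff)

lemma matrix_diff_distrib:
  fixes A B :: "complex^'n^'m" and C D :: "complex^'p^'n"
  shows "(A - B) ** C = A ** C - B ** C" and "A ** (C - D) = A ** C - A ** D"
  by (simp_all add: matrix_matrix_mult_def vec_eq_iff sum_subtractf algebra_simps)

lemma sum_matrix_mult_right: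
  fixes A :: "complex^'n^'m"
  shows "A ** (\<Sum>k\<in>K. f k) = (\<Sum>k\<in>K. A ** f k)"
  by (induction K rule: infinite_finite_induct) (simp_all add: matrix_add_ldistrib)

lemma grad_adj_adjoint:
  assumes "L \<in> herm_cols"
  shows "(\<Sum>k\<in>UNIV. trace (ctranspose (grad L X $ k) ** Y $ k))
       = trace (ctranspose X ** grad_adj L Y)"
proof -
  have L: "ctranspose (L $ k) = L $ k" for k
    using assms by (simp add: herm_cols_def herm_mats_def)
  have "trace (ctranspose (grad L X $ k) ** Y $ k)
      = trace (ctranspose X ** (L $ k ** Y $ k - Y $ k ** L $ k))" for k
    by (simp add: grad_def ctranspose_diff ctranspose_mult L matrix_diff_distrib trace_diff
        matrix_mul_assoc) (metis matrix_mul_assoc trace_mul_sym)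
  then show ?thesis
    by (simp add: grad_adj_def sum_matrix_mult_right trace_sum)
qed

lemma poly_charpoly: "poly (charpoly A) z = det (mat z - A)"
  by (simp add: charpoly_def det_def poly_sum poly_prod mat_def of_int_poly)
     (intro sum.cong arg_cong2[where f = "(*)"] prod.cong refl, auto)

lemma charpoly_gram_root:
  fixes A :: "complex^'n^'m"
  assumes "poly (charpoly (ctranspose A ** A)) z = 0"
  shows "0 \<le> Re z" and "Im z = 0"
proof -
  have "\<not> invertible (mat z - ctranspose A ** A)"
    using assms by (simp add: poly_charpoly invertible_det_nz)
  then obtain x where x: "x \<noteq> 0" "(mat z - ctranspose A ** A) *v x = 0"
    using invertible_left_inverse matrix_left_invertible_ker by blast
  have "mat z *v x = z *s x"
    by (simp add: vec_eq_iff matrix_vector_mult_def mat_def if_distrib[where f = "\<lambda>c. c * _"]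
        cong: if_cong)
  with x(2) have eq: "ctranspose A *v (A *v x) = z *s x"
    by (simp add: matrix_vector_mult_diff_rdistrib matrix_vector_mul_assoc)
  define y where "y = A *v x"
  have "(\<Sum>i\<in>UNIV. cnj (x $ i) * (ctranspose A *v y) $ i) = (\<Sum>j\<in>UNIV. cnj (y $ j) * y $ j)"
  proof -
    have "(\<Sum>i\<in>UNIV. cnj (x $ i) * (ctranspose A *v y) $ i)
        = (\<Sum>i\<in>UNIV. \<Sum>j\<in>UNIV. cnj (x $ i) * (cnj (A $ j $ i) * y $ j))"
      by (simp add: matrix_vector_mult_def ctranspose_def sum_distrib_left)
    also have "\<dots> = (\<Sum>j\<in>UNIV. \<Sum>i\<in>UNIV. cnj (x $ i) * (cnj (A $ j $ i) * y $ j))"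
      by (rule sum.swap)
    also have "\<dots> = (\<Sum>j\<in>UNIV. cnj (y $ j) * y $ j)"
      unfolding y_def matrix_vector_mult_def
      by (simp add: sum_distrib_right sum_distrib_left mult_ac)
    finally show ?thesis .
  qed
  also have "(\<Sum>i\<in>UNIV. cnj (x $ i) * (ctranspose A *v y) $ i)
      = z * (\<Sum>i\<in>UNIV. cnj (x $ i) * x $ i)"
    by (simp add: y_def eq sum_distrib_left mult_ac)
  finally have "z * (\<Sum>i\<in>UNIV. of_real ((cmod (x $ i))\<^sup>2)) = (\<Sum>j\<in>UNIV. of_real ((cmod (y $ j))\<^sup>2))"
    by (simp add: complex_norm_square[symmetric] mult.commute del: of_real_power)
  then have *: "z * of_real (\<Sum>i\<in>UNIV. (cmod (x $ i))\<^sup>2) = of_real (\<Sum>j\<in>UNIV. (cmod (y $ j))\<^sup>2)"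
    by simp
  obtain i where "x $ i \<noteq> 0"
    using x(1) by (auto simp: vec_eq_iff)
  then have pos: "(\<Sum>i\<in>UNIV. (cmod (x $ i))\<^sup>2) > 0"
    by (intro sum_pos2[of _ i]) auto
  have z: "z = of_real ((\<Sum>j\<in>UNIV. (cmod (y $ j))\<^sup>2) / (\<Sum>i\<in>UNIV. (cmod (x $ i))\<^sup>2))"
    using * pos by (simp add: field_simps del: of_real_sum)
  show "0 \<le> Re z" "Im z = 0"
    unfolding z Re_complex_of_real Im_complex_of_real
    by (auto intro!: divide_nonneg_nonneg sum_nonneg)
qed

lemma nuclear_norm_nonneg: "0 \<le> nuclear_norm A"
proof -
  have "0 \<le> sqrt (Re z)" if "z \<in># proots (charpoly (ctranspose A ** A))" for z
    using that charpoly_gram_root(1)[of A z] by (cases "charpoly (ctranspose A ** A) = 0") auto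
  then show ?thesis
    using sum_mset_mono[of "proots (charpoly (ctranspose A ** A))" "\<lambda>_. 0" "\<lambda>z. sqrt (Re z)"]
    by (simp add: nuclear_norm_def singular_values_def)
qed

(* The infimum in V1 is over a nonempty set that is bounded below. *)

lemma V1_feasible_nonempty:
  assumes "\<rho>0 \<in> psd_mats" "\<rho>1 \<in> psd_mats"
  shows "(0, \<rho>0 - \<rho>1) \<in> V1_feasible L \<rho>0 \<rho>1"
proof -
  have "(0 :: complex^'a^'a) ** A = 0" "A ** (0 :: complex^'a^'a) = 0" for A :: "complex^'a^'a"
    by (simp_all add: matrix_matrix_mult_def vec_eq_iff)
  with assms show ?thesis
    by (auto simp: V1_feasible_def psd_mats_def herm_mats_def skew_herm_cols_def
        skew_herm_mats_def grad_adj_def ctranspose_diff)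
       (simp add: ctranspose_def vec_eq_iff)
qed

lemma V1_bdd_below:
  assumes "\<alpha> > 0"
  shows "bdd_below ((\<lambda>(u, v). nuclear_norm (stack u) + \<alpha> * nuclear_norm v) ` V1_feasible L \<rho>0 \<rho>1)"
  by (rule bdd_belowI[where m = 0]) (use assms in \<open>auto simp: nuclear_norm_nonneg\<close>)

end

theory Submission
  imports Defs
begin

text \<open>
  The optimal value \<open>V1\<close> is an infimal convolution of norms, so the metric axioms all come from
  properties of the nuclear norm together with the linearity of the constraint
  \<open>\<rho>0 - \<rho>1 = grad_adj L u + v\<close>. Adding feasible pairs for \<open>(x, y)\<close> and \<open>(y, z)\<close> gives a feasible
  pair for \<open>(x, z)\<close>, so subadditivity of the nuclear norm (\<open>nuclear_norm_triangle\<close>) gives the triangle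
  inequality; changing signs gives symmetry; the pair \<open>(0, 0)\<close> gives \<open>V1 \<alpha> L x x = 0\<close>. If \<open>V1\<close>
  vanishes at \<open>(x, y)\<close>, there are feasible pairs of arbitrarily small cost. Since the nuclear norm
  dominates every entry of a matrix (\<open>entry_le_nuclear_norm\<close>) and \<open>grad_adj L\<close> is linear, every entry of
  \<open>x - y\<close> is then arbitrarily small, and \<open>x = y\<close>.

  The work is in the nuclear norm, which is given through the roots of the characteristic
  polynomial of the Gram matrix \<open>A\<^sup>* A\<close>. Diagonalising this Hermitian matrix in an orthonormal basis
  \<open>e\<close> (\<open>hermitian_eigenbasis\<close>) turns the sum over roots into \<open>\<Sum>\<^sub>j \<parallel>A e\<^sub>j\<parallel>\<close>, with pairwise orthogonal
  vectors \<open>A e\<^sub>j\<close> (\<open>right_singular_basis\<close>). From this follows the dual description of the nuclear norm: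
  it is the maximum of \<open>\<Sum>\<^sub>i Re \<langle>w\<^sub>i, A v\<^sub>i\<rangle>\<close> over systems \<open>v\<close> and \<open>w\<close> of vectors that are orthonormal
  except that some may be zero (\<open>nuclear_norm_dual_bound\<close> and \<open>nuclear_norm_dual_attained\<close>). A maximum of linear
  functionals is subadditive, and a single pair of unit coordinate vectors picks out an entry.
\<close>

section \<open>The Hermitian inner product and Bessel's inequality\<close>

definition cinner :: "complex^'n \<Rightarrow> complex^'n \<Rightarrow> complex" where
  "cinner x y = (\<Sum>i\<in>UNIV. cnj (x $ i) * y $ i)"

lemma cinner_add_right: "cinner x (y + z) = cinner x y + cinner x z"
  and cinner_add_left: "cinner (x + y) z = cinner x z + cinner y z"
  and cinner_diff_right: "cinner x (y - z) = cinner x y - cinner x z"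
  and cinner_diff_left: "cinner (x - y) z = cinner x z - cinner y z"
  and cinner_scale_right: "cinner x (c *s y) = c * cinner x y"
  and cinner_scale_left: "cinner (c *s x) y = cnj c * cinner x y"
  and cinner_zero_right [simp]: "cinner x 0 = 0"
  and cinner_zero_left [simp]: "cinner 0 x = 0"
  by (simp_all add: cinner_def sum.distrib sum_subtractf sum_distrib_left algebra_simps)

lemma cinner_sum_right: "cinner x (\<Sum>i\<in>I. f i) = (\<Sum>i\<in>I. cinner x (f i))"
  by (induction I rule: infinite_finite_induct) (simp_all add: cinner_add_right)

lemma cinner_sum_left: "cinner (\<Sum>i\<in>I. f i) x = (\<Sum>i\<in>I. cinner (f i) x)"
  by (induction I rule: infinite_finite_induct) (simp_all add: cinner_add_left)

lemma cnj_cinner: "cnj (cinner x y) = cinner y x"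
  by (simp add: cinner_def mult.commute)

lemma cinner_self: "cinner x x = of_real ((norm x)\<^sup>2)"
  by (simp add: cinner_def norm_vec_def L2_set_def real_sqrt_pow2 sum_nonneg
      complex_norm_square mult.commute del: of_real_power)

lemma Re_cinner: "Re (cinner x y) = x \<bullet> y"
  by (simp add: cinner_def inner_vec_def inner_complex_def)

lemma cinner_ctranspose: "cinner x (A *v y) = cinner (ctranspose A *v x) y"
proof -
  have "cinner x (A *v y) = (\<Sum>i\<in>UNIV. \<Sum>j\<in>UNIV. cnj (x $ i) * (A $ i $ j * y $ j))"
    by (simp add: cinner_def matrix_vector_mult_def sum_distrib_left)
  also have "\<dots> = (\<Sum>j\<in>UNIV. \<Sum>i\<in>UNIV. cnj (x $ i) * (A $ i $ j * y $ j))"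
    by (rule sum.swap)
  also have "\<dots> = cinner (ctranspose A *v x) y"
    by (simp add: cinner_def ctranspose_def matrix_vector_mult_def sum_distrib_left sum_distrib_right mult_ac)
  finally show ?thesis .
qed

lemma matrix_vector_mult_sum_right:
  fixes A :: "complex^'n^'m"
  shows "A *v (\<Sum>i\<in>I. f i) = (\<Sum>i\<in>I. A *v f i)"
  by (induction I rule: infinite_finite_induct) (simp_all add: matrix_vector_right_distrib)

lemma matrix_vector_mult_scaleR_right:
  fixes A :: "complex^'n^'m"
  shows "A *v (t *\<^sub>R y) = t *\<^sub>R (A *v y)"
  by (simp add: vec_eq_iff matrix_vector_mult_def scaleR_sum_right)

text \<open>
  Zero vectors are admitted because the left singular vectors of a matrix are only determined for
  nonzero singular values, and a matrix with fewer rows than columns does not have room for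
  one orthonormal left vector per column. Bessel's inequality holds for such systems all the same.
\<close>

definition orthonormal_or_zero :: "'i set \<Rightarrow> ('i \<Rightarrow> complex^'n) \<Rightarrow> bool" where
  "orthonormal_or_zero I w \<longleftrightarrow>
     (\<forall>i\<in>I. \<forall>j\<in>I. cinner (w i) (w j) = (if i = j \<and> w i \<noteq> 0 then 1 else 0))"

lemma cinner_projection_remainder:
  assumes "orthonormal_or_zero I w" "finite I" "i \<in> I"
  shows "cinner (w i) (x - (\<Sum>j\<in>I. cinner (w j) x *s w j)) = 0"
proof -
  have "(\<Sum>j\<in>I. cinner (w j) x * cinner (w i) (w j)) = (\<Sum>j\<in>I. if i = j then cinner (w j) x else 0)"
    using assms(1,3) by (intro sum.cong) (auto simp: orthonormal_or_zero_def)
  then show ?thesis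
    using assms(2,3) by (simp add: cinner_diff_right cinner_sum_right cinner_scale_right)
qed

lemma Bessel_inequality:
  assumes "orthonormal_or_zero I w" "finite I"
  shows "(\<Sum>i\<in>I. (cmod (cinner (w i) x))\<^sup>2) \<le> (norm x)\<^sup>2"
proof -
  define p where "p = (\<Sum>i\<in>I. cinner (w i) x *s w i)"
  \<comment> \<open>\<open>p\<close> is the orthogonal projection of \<open>x\<close> to the span of the system.\<close>
  have orth: "cinner p (x - p) = 0"
    using cinner_projection_remainder[OF assms]
    by (simp add: p_def cinner_sum_left cinner_scale_left)
  have "cinner p x = (\<Sum>i\<in>I. of_real ((cmod (cinner (w i) x))\<^sup>2))"
    unfolding p_def cinner_sum_left cinner_scale_left complex_norm_square
    by (simp add: mult.commute)
  then have px: "(\<Sum>i\<in>I. (cmod (cinner (w i) x))\<^sup>2) = Re (cinner p x)"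
    by simp
  have "Re (cinner x x) - Re (cinner p x) = Re (cinner (x - p) (x - p)) + Re (cinner (x - p) p)"
    by (simp add: cinner_diff_left cinner_diff_right)
  also have "cinner (x - p) p = 0"
    using orth cnj_cinner[of p "x - p"] by simp
  finally have "Re (cinner x x) - Re (cinner p x) = Re (cinner (x - p) (x - p))"
    by simp
  then show ?thesis
    using zero_le_power2[of "norm (x - p)"]
    by (simp only: px cinner_self Re_complex_of_real)
qed

section \<open>Diagonalisation of Hermitian matrices\<close>

text \<open>
  A unit vector of \<open>S\<close> at which the quadratic form \<open>y \<bullet> H y\<close> is maximal is an eigenvector: the derivative
  of the Rayleigh quotient vanishes there in all directions of \<open>S\<close>, and by invariance the defect
  \<open>H x - m x\<close> is itself one of these directions. The form is real, so real inner products and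
  real subspaces suffice.
\<close>

lemma hermitian_eigenvector_in_subspace:
  fixes H :: "complex^'n^'n"
  assumes herm: "H \<in> herm_mats"
    and S: "subspace S" "\<And>y. y \<in> S \<Longrightarrow> H *v y \<in> S"
    and "y0 \<in> S" "y0 \<noteq> 0"
  obtains x m where "x \<in> S" "norm x = 1" "H *v x = of_real m *s x"
proof -
  define f where "f y = y \<bullet> (H *v y)" for y :: "complex^'n"
  define K where "K = S \<inter> sphere 0 1"
  have "compact K"
    unfolding K_def using closed_subspace[OF S(1)] by (intro closed_Int_compact) auto
  moreover have "(1 / norm y0) *\<^sub>R y0 \<in> K"
    using assms(4,5) S(1) by (simp add: K_def subspace_scale)
  moreover have "continuous_on K f"
    unfolding f_def by (intro continuous_intros linear_continuous_on
        linear_linear[THEN iffD2] matrix_vector_mul_linear)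
  ultimately obtain x where x: "x \<in> K" "\<And>y. y \<in> K \<Longrightarrow> f y \<le> f x"
    using continuous_attains_sup[of K f] by blast
  define m where "m = f x"
  have scale: "f (t *\<^sub>R y) = t\<^sup>2 * f y" for t y
    by (simp add: f_def matrix_vector_mult_scaleR_right power2_eq_square)
  have f_le: "f y \<le> m * (norm y)\<^sup>2" if "y \<in> S" for y
  proof (cases "y = 0")
    case False
    then have "f ((1 / norm y) *\<^sub>R y) \<le> m"
      unfolding m_def using that S(1) by (intro x(2)) (simp add: K_def subspace_scale)
    then show ?thesis
      using False by (simp add: scale field_simps)
  qed (simp add: f_def)
  have "x \<in> S" "norm x = 1"
    using x(1) by (auto simp: K_def)
  define y where "y = H *v x - m *\<^sub>R x"
  have "y \<in> S"
    unfolding y_def using \<open>x \<in> S\<close> S by (intro subspace_diff subspace_scale) auto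
  have sym: "x \<bullet> (H *v y) = y \<bullet> (H *v x)"
  proof -
    have "x \<bullet> (H *v y) = Re (cinner (H *v x) y)"
      using herm cinner_ctranspose[of x H y] by (simp add: Re_cinner[symmetric] herm_mats_def)
    then show ?thesis
      by (simp add: Re_cinner inner_commute)
  qed
  \<comment> \<open>Comparing \<open>f\<close> with its bound along the line \<open>x + t y\<close> gives an inequality between a linear
    and a quadratic term in \<open>t\<close>, which for small \<open>t > 0\<close> forces the linear coefficient to vanish.\<close>
  define d where "d = m * (norm y)\<^sup>2 - f y"
  have d: "d \<ge> 0"
    using f_le[OF \<open>y \<in> S\<close>] by (simp add: d_def)
  have quad: "2 * t * (norm y)\<^sup>2 \<le> t\<^sup>2 * d" for t
  proof -
    have "f (x + t *\<^sub>R y) \<le> m * (norm (x + t *\<^sub>R y))\<^sup>2"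
      using \<open>x \<in> S\<close> \<open>y \<in> S\<close> S(1) by (intro f_le) (simp add: subspace_add subspace_scale)
    moreover have "f (x + t *\<^sub>R y) = m + 2 * t * (y \<bullet> (H *v x)) + t\<^sup>2 * f y"
      by (simp add: f_def m_def matrix_vector_right_distrib matrix_vector_mult_scaleR_right
          inner_add_left inner_add_right sym power2_eq_square algebra_simps)
    moreover have "(norm (x + t *\<^sub>R y))\<^sup>2 = 1 + 2 * t * (y \<bullet> x) + t\<^sup>2 * (norm y)\<^sup>2"
      using \<open>norm x = 1\<close> unfolding norm_eq_1 power2_norm_eq_inner
      by (simp add: inner_add_left inner_add_right inner_commute power2_eq_square algebra_simps)
    ultimately have "2 * t * (y \<bullet> (H *v x) - m * (y \<bullet> x)) \<le> t\<^sup>2 * d"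
      by (simp add: d_def algebra_simps)
    moreover have "(norm y)\<^sup>2 = y \<bullet> (H *v x) - m * (y \<bullet> x)"
      by (subst power2_norm_eq_inner) (simp add: y_def inner_diff_right inner_diff_left)
    ultimately show ?thesis
      by simp
  qed
  have "y = 0"
  proof (rule ccontr)
    assume "y \<noteq> 0"
    define c where "c = (norm y)\<^sup>2"
    have "c > 0"
      using \<open>y \<noteq> 0\<close> by (simp add: c_def)
    define t where "t = c / (d + 1)"
    have "t > 0"
      using d \<open>c > 0\<close> by (simp add: t_def)
    have "t * d \<le> c"
      using d \<open>c > 0\<close> by (simp add: t_def field_simps)
    then have "t * (t * d) \<le> t * c"
      using \<open>t > 0\<close> by (intro mult_left_mono) auto
    moreover have "2 * (t * c) \<le> t * (t * d)"
      using quad[of t] by (simp add: c_def power2_eq_square mult_ac)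
    ultimately show False
      using mult_pos_pos[OF \<open>t > 0\<close> \<open>c > 0\<close>] by linarith
  qed
  then have "H *v x = of_real m *s x"
    by (simp add: y_def vec_eq_iff scaleR_conv_of_real[symmetric])
  with \<open>x \<in> S\<close> \<open>norm x = 1\<close> show thesis
    by (rule that)
qed

text \<open>
  The expansion writes the identity matrix as the sum of the rank-one projections \<open>e e\<^sup>*\<close>, each of
  trace 1; the cardinality is read off from the trace.
\<close>

lemma card_complete_orthonormal:
  fixes E :: "(complex^'n) set"
  assumes "finite E" "\<And>e. e \<in> E \<Longrightarrow> norm e = 1"
    and expand: "\<And>x. x = (\<Sum>e\<in>E. cinner e x *s e)"
  shows "card E = CARD('n)"
proof -
  have "of_nat CARD('n) = (\<Sum>i\<in>(UNIV::'n set). axis i (1::complex) $ i)"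
    by simp
  also have "\<dots> = (\<Sum>i\<in>(UNIV::'n set). \<Sum>e\<in>E. cnj (e $ i) * e $ i)"
  proof (rule sum.cong)
    fix i :: 'n
    have "cinner e (axis i 1) = cnj (e $ i)" for e
      by (simp add: cinner_def axis_def if_distrib cong: if_cong)
    then show "axis i (1::complex) $ i = (\<Sum>e\<in>E. cnj (e $ i) * e $ i)"
      using arg_cong[OF expand[of "axis i 1"], of "\<lambda>v. v $ i"] by simp
  qed simp
  also have "\<dots> = (\<Sum>e\<in>E. cinner e e)"
    unfolding cinner_def by (rule sum.swap)
  also have "\<dots> = of_nat (card E)"
    using assms(2) by (simp add: cinner_self)
  finally show ?thesis
    using of_nat_eq_iff by metis
qed

text \<open>
  While there are fewer than \<open>CARD('n)\<close> eigenvectors, their orthogonal complement is a nonzero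
  subspace. It is invariant because \<open>H\<close> is Hermitian, so it contains a further eigenvector.
\<close>

lemma hermitian_orthonormal_eigenvectors:
  fixes H :: "complex^'n^'n"
  assumes herm: "H \<in> herm_mats" and "k \<le> CARD('n)"
  shows "\<exists>E. finite E \<and> card E = k \<and> (\<forall>e\<in>E. norm e = 1 \<and> (\<exists>m. H *v e = of_real m *s e)) \<and>
    (\<forall>e\<in>E. \<forall>e'\<in>E. e \<noteq> e' \<longrightarrow> cinner e e' = 0)"
  using assms(2)
proof (induction k)
  case 0
  show ?case by (intro exI[of _ "{}"]) auto
next
  case (Suc k)
  then obtain E where E: "finite E" "card E = k"
    "\<And>e. e \<in> E \<Longrightarrow> norm e = 1" "\<And>e. e \<in> E \<Longrightarrow> \<exists>m. H *v e = of_real m *s e"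
    "\<And>e e'. e \<in> E \<Longrightarrow> e' \<in> E \<Longrightarrow> e \<noteq> e' \<Longrightarrow> cinner e e' = 0"
    using Suc_leD by metis
  have on: "orthonormal_or_zero E (\<lambda>e. e)"
    using E(3,5) by (auto simp: orthonormal_or_zero_def cinner_self)
  define S where "S = {y. \<forall>e\<in>E. cinner e y = 0}"
  obtain x where x: "x \<noteq> (\<Sum>e\<in>E. cinner e x *s e)"
    using card_complete_orthonormal[OF E(1,3)] E(2) Suc.prems by fastforce
  define y0 where "y0 = x - (\<Sum>e\<in>E. cinner e x *s e)"
  have "y0 \<in> S" "y0 \<noteq> 0"
    using x cinner_projection_remainder[OF on E(1)] by (auto simp: S_def y0_def)
  have "cinner e (t *\<^sub>R y) = of_real t * cinner e y" for e y :: "complex^'n" and t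
    by (simp add: cinner_def scaleR_conv_of_real[symmetric] scaleR_sum_right)
  then have "subspace S"
    by (auto simp: subspace_def S_def cinner_add_right)
  moreover have "H *v y \<in> S" if "y \<in> S" for y
    unfolding S_def
  proof safe
    fix e assume "e \<in> E"
    then obtain m where "H *v e = of_real m *s e"
      using E(4) by blast
    then show "cinner e (H *v y) = 0"
      using herm that \<open>e \<in> E\<close>
      by (simp add: cinner_ctranspose herm_mats_def cinner_scale_left S_def)
  qed
  ultimately obtain e m where e: "e \<in> S" "norm e = 1" "H *v e = of_real m *s e"
    using hermitian_eigenvector_in_subspace[OF herm] \<open>y0 \<in> S\<close> \<open>y0 \<noteq> 0\<close> by blast
  have "e \<notin> E"
    using e(1,2) by (auto simp: S_def cinner_self)
  moreover have "cinner e' e = 0" "cinner e e' = 0" if "e' \<in> E" for e'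
    using e(1) that cnj_cinner[of e' e] by (auto simp: S_def)
  ultimately show ?case
    using E e by (intro exI[of _ "insert e E"]) auto
qed

lemma hermitian_eigenbasis:
  fixes H :: "complex^'n^'n"
  assumes "H \<in> herm_mats"
  obtains e :: "'n \<Rightarrow> complex^'n" and m :: "'n \<Rightarrow> real"
    where "\<And>i j. cinner (e i) (e j) = (if i = j then 1 else 0)"
      and "\<And>j. H *v e j = of_real (m j) *s e j"
proof -
  obtain E where E: "finite E" "card E = CARD('n)"
    "\<And>e. e \<in> E \<Longrightarrow> norm e = 1" "\<And>e. e \<in> E \<Longrightarrow> \<exists>m. H *v e = of_real m *s e"
    "\<And>e e'. e \<in> E \<Longrightarrow> e' \<in> E \<Longrightarrow> e \<noteq> e' \<Longrightarrow> cinner e e' = 0"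
    using hermitian_orthonormal_eigenvectors[OF assms order_refl] by metis
  obtain e where e: "bij_betw e (UNIV :: 'n set) E"
    using finite_same_card_bij[of "UNIV :: 'n set" E] E(1,2) by auto
  have eE: "e i \<in> E" for i
    using e by (auto simp: bij_betw_def)
  obtain m where "\<And>j. H *v e j = of_real (m j) *s e j"
    using E(4)[OF eE] by metis
  moreover have "cinner (e i) (e j) = (if i = j then 1 else 0)" for i j
  proof (cases "i = j")
    case False
    then have "e i \<noteq> e j"
      using e by (auto simp: bij_betw_def inj_def)
    then show ?thesis
      using E(5)[OF eE eE] False by simp
  qed (simp add: cinner_self E(3)[OF eE])
  ultimately show thesis
    by (rule that[rotated])
qed

definition column_matrix :: "('n \<Rightarrow> complex^'m) \<Rightarrow> complex^'n^'m" where
  "column_matrix e = (\<chi> i j. e j $ i)"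

lemma ctranspose_column_matrix_self:
  fixes e :: "'n \<Rightarrow> complex^'n"
  assumes "\<And>i j. cinner (e i) (e j) = (if i = j then 1 else 0)"
  shows "ctranspose (column_matrix e) ** column_matrix e = mat 1"
  using assms
  by (simp add: vec_eq_iff matrix_matrix_mult_def ctranspose_def column_matrix_def mat_def cinner_def)

text \<open>
  The columns of a square matrix \<open>U\<close> with \<open>U\<^sup>* U = 1\<close> also satisfy \<open>U U\<^sup>* = 1\<close>, which is the
  completeness of the basis.
\<close>

lemma orthonormal_basis_expansion:
  fixes e :: "'n \<Rightarrow> complex^'n"
  assumes "\<And>i j. cinner (e i) (e j) = (if i = j then 1 else 0)"
  shows "x = (\<Sum>j\<in>UNIV. cinner (e j) x *s e j)"
proof -
  let ?U = "column_matrix e"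
  have "?U ** ctranspose ?U = mat 1"
    using ctranspose_column_matrix_self[OF assms] matrix_left_right_inverse by blast
  then have "x = ?U *v (ctranspose ?U *v x)"
    by (simp add: matrix_vector_mul_assoc)
  also have "\<dots> = (\<Sum>j\<in>UNIV. cinner (e j) x *s e j)"
    by (simp add: vec_eq_iff matrix_vector_mult_def ctranspose_def column_matrix_def cinner_def
        mult.commute)
  finally show ?thesis .
qed

text \<open>
  Conjugation by the matrix \<open>U\<close> of eigenvectors shows that \<open>z - H\<close> has the same determinant as the diagonal
  matrix with entries \<open>z - m\<^sub>j\<close>, so the roots of the characteristic polynomial are the \<open>m\<^sub>j\<close>
  with the correct multiplicities.
\<close>

lemma proots_charpoly_eigenbasis:
  fixes H :: "complex^'n^'n" and e :: "'n \<Rightarrow> complex^'n" and m :: "'n \<Rightarrow> complex"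
  assumes on: "\<And>i j. cinner (e i) (e j) = (if i = j then 1 else 0)"
    and eig: "\<And>j. H *v e j = m j *s e j"
  shows "proots (charpoly H) = image_mset m (mset_set UNIV)"
proof -
  let ?U = "column_matrix e"
  define D :: "complex^'n^'n" where "D = (\<chi> i j. if i = j then m j else 0)"
  have "det (ctranspose ?U ** ?U) \<noteq> 0"
    by (simp add: ctranspose_column_matrix_self[OF on])
  then have U: "det ?U \<noteq> 0"
    by (simp add: det_mul)
  have "(H ** ?U) $ i $ j = (H *v e j) $ i" for i j
    by (simp add: matrix_matrix_mult_def matrix_vector_mult_def column_matrix_def)
  then have HU: "H ** ?U = ?U ** D"
    by (simp add: eig vec_eq_iff) (simp add: matrix_matrix_mult_def column_matrix_def D_def
        if_distrib mult.commute cong: if_cong)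
  have "poly (charpoly H) z = poly (\<Prod>j\<in>UNIV. [:- m j, 1:]) z" for z
  proof -
    have "mat z ** ?U = ?U ** mat z"
      by (simp add: vec_eq_iff matrix_matrix_mult_def mat_def if_distrib if_distribR
          mult.commute cong: if_cong)
    then have "(mat z - H) ** ?U = ?U ** (mat z - D)"
      by (simp add: matrix_diff_distrib HU)
    then have "det (mat z - H) * det ?U = det ?U * det (mat z - D)"
      by (metis det_mul)
    then have "det (mat z - H) = det (mat z - D)"
      using U by simp
    also have "\<dots> = (\<Prod>j\<in>UNIV. z - m j)"
      by (subst det_diagonal) (auto simp: mat_def D_def)
    finally show ?thesis
      by (simp add: poly_charpoly poly_prod)
  qed
  then have "charpoly H = (\<Prod>j\<in>UNIV. [:- m j, 1:])"
    by (simp add: poly_eq_poly_eq_iff[symmetric] fun_eq_iff)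
  then have "proots (charpoly H) = (\<Sum>j\<in>UNIV. {#m j#})"
    by (simp add: proots_prod)
  also have "\<dots> = image_mset m (mset_set UNIV)"
    by (simp add: sum_unfold_sum_mset)
  finally show ?thesis .
qed

section \<open>The nuclear norm as a dual norm\<close>

text \<open>
  An eigenbasis of the Gram matrix does this: \<open>\<langle>A e\<^sub>i, A e\<^sub>j\<rangle> = \<langle>A\<^sup>* A e\<^sub>i, e\<^sub>j\<rangle>\<close> vanishes off the diagonal and is the
  eigenvalue on it, so that \<open>\<parallel>A e\<^sub>j\<parallel>\<close> is the \<open>j\<close>-th singular value.
\<close>

lemma right_singular_basis:
  fixes A :: "complex^'n^'m"
  obtains e :: "'n \<Rightarrow> complex^'n"
    where "\<And>i j. cinner (e i) (e j) = (if i = j then 1 else 0)"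
      and "\<And>i j. i \<noteq> j \<Longrightarrow> cinner (A *v e i) (A *v e j) = 0"
      and "nuclear_norm A = (\<Sum>j\<in>UNIV. norm (A *v e j))"
proof -
  let ?H = "ctranspose A ** A"
  have "?H \<in> herm_mats"
    by (simp add: herm_mats_def ctranspose_mult) (simp add: ctranspose_def)
  then obtain e :: "'n \<Rightarrow> complex^'n" and m :: "'n \<Rightarrow> real"
    where on: "\<And>i j. cinner (e i) (e j) = (if i = j then 1 else 0)"
      and eig: "\<And>j. ?H *v e j = of_real (m j) *s e j"
    using hermitian_eigenbasis by metis
  have gram: "cinner (A *v e i) (A *v e j) = (if i = j then of_real (m j) else 0)" for i j
  proof -
    have "cinner (A *v e i) (A *v e j) = cinner (?H *v e i) (e j)"
      by (simp add: cinner_ctranspose matrix_vector_mul_assoc)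
    then show ?thesis
      by (simp add: eig cinner_scale_left on)
  qed
  have "norm (A *v e j) = sqrt (m j)" for j
    using gram[of j j] by (simp add: cinner_self of_real_eq_iff del: of_real_power) 
      (metis norm_ge_zero real_sqrt_unique)
  then have "nuclear_norm A = (\<Sum>j\<in>UNIV. norm (A *v e j))"
    by (simp add: nuclear_norm_def singular_values_def proots_charpoly_eigenbasis[OF on eig]
        sum_unfold_sum_mset multiset.map_comp o_def)
  with on gram show thesis
    by (intro that[of e]) auto
qed

text \<open>
  Expand each \<open>v\<^sub>i\<close> in a right singular basis \<open>e\<close>. For fixed \<open>j\<close>, the coefficients \<open>\<langle>v\<^sub>i, e\<^sub>j\<rangle>\<close> and
  \<open>\<langle>w\<^sub>i, A e\<^sub>j\<rangle>\<close> are by Bessel's inequality square-summable with norms at most \<open>1\<close> and \<open>\<parallel>A e\<^sub>j\<parallel>\<close>, and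
  the Cauchy-Schwarz inequality over \<open>i\<close> bounds their contribution by the \<open>j\<close>-th singular value.
\<close>

lemma nuclear_norm_dual_bound:
  fixes A :: "complex^'n^'m"
  assumes v: "orthonormal_or_zero I v" and w: "orthonormal_or_zero I w" and "finite I"
  shows "(\<Sum>i\<in>I. cmod (cinner (w i) (A *v v i))) \<le> nuclear_norm A"
proof -
  obtain e :: "'n \<Rightarrow> complex^'n"
    where on: "\<And>i j. cinner (e i) (e j) = (if i = j then 1 else 0)"
      and nn: "nuclear_norm A = (\<Sum>j\<in>UNIV. norm (A *v e j))"
    using right_singular_basis by metis
  have L2: "L2_set (\<lambda>i. cmod (cinner (u i) x)) I \<le> norm x"
    if "orthonormal_or_zero I u" for u :: "_ \<Rightarrow> complex^'k" and x
    using Bessel_inequality[OF that \<open>finite I\<close>, of x] by (simp add: L2_set_def real_le_lsqrt)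
  have "cmod (cinner (w i) (A *v v i)) \<le>
      (\<Sum>j\<in>UNIV. cmod (cinner (v i) (e j)) * cmod (cinner (w i) (A *v e j)))" for i
  proof -
    have "A *v v i = (\<Sum>j\<in>UNIV. cinner (e j) (v i) *s (A *v e j))"
      by (subst orthonormal_basis_expansion[OF on, of "v i"])
        (simp add: matrix_vector_mult_sum_right vector_scalar_commute)
    then have "cinner (w i) (A *v v i) =
        (\<Sum>j\<in>UNIV. cinner (e j) (v i) * cinner (w i) (A *v e j))"
      by (simp add: cinner_sum_right cinner_scale_right)
    also have "cmod \<dots> \<le> (\<Sum>j\<in>UNIV. cmod (cinner (e j) (v i) * cinner (w i) (A *v e j)))"
      by (rule norm_sum)
    finally show ?thesis
      by (simp add: norm_mult cnj_cinner[of "e _" "v i", symmetric])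
  qed
  then have "(\<Sum>i\<in>I. cmod (cinner (w i) (A *v v i))) \<le>
      (\<Sum>i\<in>I. \<Sum>j\<in>UNIV. cmod (cinner (v i) (e j)) * cmod (cinner (w i) (A *v e j)))"
    by (rule sum_mono)
  also have "\<dots> = (\<Sum>j\<in>UNIV. \<Sum>i\<in>I. cmod (cinner (v i) (e j)) * cmod (cinner (w i) (A *v e j)))"
    by (rule sum.swap)
  also have "\<dots> \<le> (\<Sum>j\<in>UNIV. norm (A *v e j))"
  proof (rule sum_mono)
    fix j
    have "norm (e j) = 1"
      using on[of j j] Re_cinner[of "e j" "e j"] by (simp add: norm_eq_1)
    have "(\<Sum>i\<in>I. cmod (cinner (v i) (e j)) * cmod (cinner (w i) (A *v e j))) \<le>
        L2_set (\<lambda>i. cmod (cinner (v i) (e j))) I * L2_set (\<lambda>i. cmod (cinner (w i) (A *v e j))) I"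
      using L2_set_mult_ineq[of "\<lambda>i. cmod (cinner (v i) (e j))" "\<lambda>i. cmod (cinner (w i) (A *v e j))" I]
      by simp
    also have "\<dots> \<le> norm (e j) * norm (A *v e j)"
      by (intro mult_mono L2 v w) auto
    finally show "(\<Sum>i\<in>I. cmod (cinner (v i) (e j)) * cmod (cinner (w i) (A *v e j)))
        \<le> norm (A *v e j)"
      using \<open>norm (e j) = 1\<close> by simp
  qed
  finally show ?thesis
    by (simp add: nn)
qed

text \<open>
  The maximum is reached at the right singular vectors \<open>v\<close> and the left singular vectors \<open>w\<close>.
\<close>

lemma nuclear_norm_dual_attained:
  fixes A :: "complex^'n^'m"
  obtains v :: "'n \<Rightarrow> complex^'n" and w
    where "orthonormal_or_zero UNIV v" "orthonormal_or_zero UNIV w"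
      and "nuclear_norm A = (\<Sum>i\<in>UNIV. Re (cinner (w i) (A *v v i)))"
proof -
  obtain e :: "'n \<Rightarrow> complex^'n"
    where on: "\<And>i j. cinner (e i) (e j) = (if i = j then 1 else 0)"
      and orth: "\<And>i j. i \<noteq> j \<Longrightarrow> cinner (A *v e i) (A *v e j) = 0"
      and nn: "nuclear_norm A = (\<Sum>j\<in>UNIV. norm (A *v e j))"
    using right_singular_basis by metis
  \<comment> \<open>Since \<open>inverse 0 = 0\<close>, the vector \<open>w j\<close> is zero when the singular value is.\<close>
  define w where "w j = of_real (inverse (norm (A *v e j))) *s (A *v e j)" for j
  have "orthonormal_or_zero UNIV e"
    unfolding orthonormal_or_zero_def using on by (metis cinner_zero_left zero_neq_one)
  moreover have wA: "cinner (w j) (A *v e j) = of_real (norm (A *v e j))" for j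
    by (cases "A *v e j = 0")
      (simp_all add: w_def cinner_scale_left cinner_self power2_eq_square)
  moreover have "cinner (w i) (w j) = (if i = j \<and> w i \<noteq> 0 then 1 else 0)" for i j
  proof (cases "i = j \<and> w i \<noteq> 0")
    case True
    then have "A *v e i \<noteq> 0"
      by (auto simp: w_def)
    then show ?thesis
      using True wA[of i] by (simp add: w_def[of j] cinner_scale_right)
  qed (auto simp: w_def cinner_scale_left cinner_scale_right orth)
  then have "orthonormal_or_zero UNIV w"
    by (simp add: orthonormal_or_zero_def)
  ultimately show thesis
    by (intro that[of e w]) (simp_all add: nn)
qed

text \<open>
  The dual systems that are optimal for \<open>A + B\<close> are admissible for \<open>A\<close> and for \<open>B\<close>.
\<close>

lemma nuclear_norm_triangle: "nuclear_norm (A + B) \<le> nuclear_norm A + nuclear_norm B"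
  for A B :: "complex^'n^'m"
proof -
  obtain v :: "'n \<Rightarrow> complex^'n" and w
    where vw: "orthonormal_or_zero UNIV v" "orthonormal_or_zero UNIV w"
      and nn: "nuclear_norm (A + B) = (\<Sum>i\<in>UNIV. Re (cinner (w i) ((A + B) *v v i)))"
    using nuclear_norm_dual_attained by metis
  have *: "(\<Sum>i\<in>UNIV. Re (cinner (w i) (M *v v i))) \<le> nuclear_norm M" for M
    by (rule order_trans[OF sum_mono nuclear_norm_dual_bound[OF vw finite]]) (rule complex_Re_le_cmod)
  show ?thesis
    using *[of A] *[of B]
    by (simp add: nn matrix_vector_mult_add_rdistrib cinner_add_right sum.distrib)
qed

lemma entry_le_nuclear_norm: "cmod (A $ i $ j) \<le> nuclear_norm A"
  for A :: "complex^'n^'m"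
proof -
  have "cinner (axis i 1) (A *v axis j 1) = A $ i $ j"
    by (simp add: cinner_def axis_def matrix_vector_mult_def if_distrib if_distribR cong: if_cong)
  \<comment> \<open>The index set has one element, and the system consists of one coordinate vector.\<close>
  then show ?thesis
    using nuclear_norm_dual_bound[of "{()}" "\<lambda>_. axis j 1" "\<lambda>_. axis i 1" A]
    by (simp add: orthonormal_or_zero_def axis_eq_0_iff cinner_self)
qed

lemma nuclear_norm_minus: "nuclear_norm (- A) = nuclear_norm A"
proof -
  have "ctranspose (- A) ** (- A) = ctranspose A ** A"
    by (simp add: vec_eq_iff ctranspose_def matrix_matrix_mult_def)
  then show ?thesis
    by (simp add: nuclear_norm_def singular_values_def)
qed

lemma nuclear_norm_zero: "nuclear_norm (0 :: complex^'n^'m) = 0"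
proof -
  obtain e :: "'n \<Rightarrow> complex^'n" where
    "nuclear_norm (0 :: complex^'n^'m) = (\<Sum>j\<in>UNIV. norm ((0 :: complex^'n^'m) *v e j))"
    using right_singular_basis by metis
  then show ?thesis
    by simp
qed

section \<open>Feasible pairs and their cost\<close>

lemma stack_add: "stack (u + v) = stack u + stack v"
  and stack_minus: "stack (- u) = - stack u"
  and stack_zero: "stack 0 = 0"
  by (simp_all add: stack_def vec_eq_iff)

lemma grad_adj_add: "grad_adj L (u + v) = grad_adj L u + grad_adj L v"
  and grad_adj_minus: "grad_adj L (- u) = - grad_adj L u"
  by (simp_all add: grad_adj_def vec_eq_iff matrix_matrix_mult_def sum.distrib sum_subtractf
      sum_negf algebra_simps)

lemma V1_feasible_add:
  assumes "(u, v) \<in> V1_feasible L x y" "(u', v') \<in> V1_feasible L y z"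
  shows "(u + u', v + v') \<in> V1_feasible L x z"
  using assms
  by (auto simp: V1_feasible_def grad_adj_add skew_herm_cols_def skew_herm_mats_def herm_mats_def
      ctranspose_def vec_eq_iff algebra_simps)

lemma V1_feasible_swap:
  assumes "(u, v) \<in> V1_feasible L x y"
  shows "(- u, - v) \<in> V1_feasible L y x"
  using assms
  by (auto simp: V1_feasible_def grad_adj_minus skew_herm_cols_def skew_herm_mats_def herm_mats_def
      ctranspose_def vec_eq_iff algebra_simps)

definition V1_cost :: "real \<Rightarrow> (complex^'n^'n^'b) \<times> (complex^'n^'n) \<Rightarrow> real" where
  "V1_cost \<alpha> = (\<lambda>(u, v). nuclear_norm (stack u) + \<alpha> * nuclear_norm v)"

lemma V1_le_cost:
  assumes "\<alpha> > 0" "x \<in> psd_mats" "y \<in> psd_mats" "p \<in> V1_feasible L x y"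
  shows "V1 \<alpha> L x y \<le> V1_cost \<alpha> p"
  using cINF_lower[OF V1_bdd_below[OF assms(1)] assms(4)] assms(2,3)
  by (simp add: V1_def V1_cost_def)

lemma V1_near_optimal:
  assumes "\<alpha> > 0" "x \<in> psd_mats" "y \<in> psd_mats" "\<epsilon> > 0"
  obtains u v where "(u, v) \<in> V1_feasible L x y" "V1_cost \<alpha> (u, v) < V1 \<alpha> L x y + \<epsilon>"
proof -
  have "V1_feasible L x y \<noteq> {}"
    using V1_feasible_nonempty[OF assms(2,3)] by auto
  moreover have "V1 \<alpha> L x y = (INF p \<in> V1_feasible L x y. V1_cost \<alpha> p)"
    using assms(2,3) by (simp add: V1_def V1_cost_def)
  moreover have "bdd_below (V1_cost \<alpha> ` V1_feasible L x y)"
    unfolding V1_cost_def by (rule V1_bdd_below[OF assms(1)])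
  ultimately have "\<exists>p\<in>V1_feasible L x y. V1_cost \<alpha> p < V1 \<alpha> L x y + \<epsilon>"
    using assms(4) by (metis cINF_less_iff less_add_same_cancel1)
  then show thesis
    using that by (metis surj_pair)
qed

lemma V1_cost_nonneg: "\<alpha> > 0 \<Longrightarrow> 0 \<le> V1_cost \<alpha> p"
  by (auto simp: V1_cost_def nuclear_norm_nonneg split: prod.split)

lemma V1_cost_add:
  "\<alpha> > 0 \<Longrightarrow> V1_cost \<alpha> (u + u', v + v') \<le> V1_cost \<alpha> (u, v) + V1_cost \<alpha> (u', v')"
  using nuclear_norm_triangle[of "stack u" "stack u'"]
    mult_left_mono[OF nuclear_norm_triangle[of v v'], of \<alpha>]
  by (simp add: V1_cost_def stack_add algebra_simps)

lemma V1_nonneg: "0 \<le> V1 \<alpha> L x y" if "\<alpha> > 0"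
proof (cases "x \<in> psd_mats \<and> y \<in> psd_mats")
  case True
  then have "V1_feasible L x y \<noteq> {}"
    using V1_feasible_nonempty by blast
  then have "0 \<le> (INF p \<in> V1_feasible L x y. V1_cost \<alpha> p)"
    by (rule cINF_greatest) (rule V1_cost_nonneg[OF that])
  then show ?thesis
    using True by (simp add: V1_def V1_cost_def)
qed (auto simp: V1_def)

section \<open>The metric axioms\<close>

lemma V1_triangle:
  assumes "\<alpha> > 0" "x \<in> psd_mats" "y \<in> psd_mats" "z \<in> psd_mats"
  shows "V1 \<alpha> L x z \<le> V1 \<alpha> L x y + V1 \<alpha> L y z"
proof (rule field_le_epsilon)
  fix \<epsilon> :: real assume "\<epsilon> > 0"
  obtain u v where uv: "(u, v) \<in> V1_feasible L x y" "V1_cost \<alpha> (u, v) < V1 \<alpha> L x y + \<epsilon> / 2"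
    using V1_near_optimal[OF assms(1-3) half_gt_zero[OF \<open>\<epsilon> > 0\<close>]] by blast
  obtain u' v' where uv': "(u', v') \<in> V1_feasible L y z" "V1_cost \<alpha> (u', v') < V1 \<alpha> L y z + \<epsilon> / 2"
    using V1_near_optimal[OF assms(1,3,4) half_gt_zero[OF \<open>\<epsilon> > 0\<close>]] by blast
  have "V1 \<alpha> L x z \<le> V1_cost \<alpha> (u + u', v + v')"
    by (rule V1_le_cost[OF assms(1,2,4) V1_feasible_add[OF uv(1) uv'(1)]])
  also have "\<dots> \<le> V1_cost \<alpha> (u, v) + V1_cost \<alpha> (u', v')"
    by (rule V1_cost_add[OF assms(1)])
  finally show "V1 \<alpha> L x z \<le> V1 \<alpha> L x y + V1 \<alpha> L y z + \<epsilon>"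
    using uv(2) uv'(2) by simp
qed

lemma V1_commute_le:
  assumes "\<alpha> > 0"
  shows "V1 \<alpha> L x y \<le> V1 \<alpha> L y x"
proof (cases "x \<in> psd_mats \<and> y \<in> psd_mats")
  case True
  show ?thesis
  proof (rule field_le_epsilon)
    fix \<epsilon> :: real assume "\<epsilon> > 0"
    then obtain u v where uv: "(u, v) \<in> V1_feasible L y x" "V1_cost \<alpha> (u, v) < V1 \<alpha> L y x + \<epsilon>"
      using V1_near_optimal[OF assms] True by metis
    have "V1 \<alpha> L x y \<le> V1_cost \<alpha> (- u, - v)"
      using True by (intro V1_le_cost[OF assms _ _ V1_feasible_swap[OF uv(1)]]) auto
    also have "\<dots> = V1_cost \<alpha> (u, v)"
      by (simp add: V1_cost_def stack_minus nuclear_norm_minus)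
    finally show "V1 \<alpha> L x y \<le> V1 \<alpha> L y x + \<epsilon>"
      using uv(2) by simp
  qed
qed (auto simp: V1_def)

lemma V1_refl:
  fixes L :: "complex^'n^'n^'b"
  assumes "\<alpha> > 0" "x \<in> psd_mats"
  shows "V1 \<alpha> L x x = 0"
proof -
  have "V1 \<alpha> L x x \<le> V1_cost \<alpha> (0 :: complex^'n^'n^'b, x - x)"
    by (rule V1_le_cost[OF assms assms(2) V1_feasible_nonempty[OF assms(2,2)]])
  also have "\<dots> = 0"
    by (simp add: V1_cost_def stack_zero nuclear_norm_zero)
  finally show ?thesis
    using V1_nonneg[OF assms(1), of L x x] by simp
qed

text \<open>
  A quantitative form of the continuity of \<open>grad_adj L\<close>. The constant is crude; it only matters that it
  does not depend on \<open>u\<close>.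
\<close>

lemma cmod_grad_adj_entry_le:
  fixes L u :: "complex^'n^'n^'b"
  shows "cmod (grad_adj L u $ i $ j) \<le>
    (\<Sum>k\<in>UNIV. \<Sum>l\<in>UNIV. cmod (L $ k $ i $ l) + cmod (L $ k $ l $ j)) * nuclear_norm (stack u)"
proof -
  have u: "cmod (u $ k $ a $ b) \<le> nuclear_norm (stack u)" for k a b
    using entry_le_nuclear_norm[of "stack u" "(k, a)" b] by (simp add: stack_def)
  have "grad_adj L u $ i $ j =
      (\<Sum>k\<in>UNIV. \<Sum>l\<in>UNIV. L $ k $ i $ l * u $ k $ l $ j - u $ k $ i $ l * L $ k $ l $ j)"
    by (simp add: grad_adj_def matrix_matrix_mult_def sum_subtractf)
  also have "cmod \<dots> \<le> (\<Sum>k\<in>UNIV. \<Sum>l\<in>UNIV.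
      (cmod (L $ k $ i $ l) + cmod (L $ k $ l $ j)) * nuclear_norm (stack u))"
  proof (intro sum_norm_le)
    fix k l
    have "cmod (L $ k $ i $ l * u $ k $ l $ j - u $ k $ i $ l * L $ k $ l $ j) \<le>
        cmod (L $ k $ i $ l) * cmod (u $ k $ l $ j) + cmod (L $ k $ l $ j) * cmod (u $ k $ i $ l)"
      by (rule order_trans[OF norm_triangle_ineq4]) (simp add: norm_mult mult.commute)
    also have "\<dots> \<le> cmod (L $ k $ i $ l) * nuclear_norm (stack u) +
        cmod (L $ k $ l $ j) * nuclear_norm (stack u)"
      by (intro add_mono mult_left_mono u) auto
    finally show "cmod (L $ k $ i $ l * u $ k $ l $ j - u $ k $ i $ l * L $ k $ l $ j) \<le>
        (cmod (L $ k $ i $ l) + cmod (L $ k $ l $ j)) * nuclear_norm (stack u)"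
      by (simp add: algebra_simps)
  qed
  finally show ?thesis
    by (simp add: sum_distrib_right)
qed

text \<open>
  The entries of \<open>x - y = grad_adj L u + v\<close> are at most a fixed multiple \<open>K\<close> of the cost of any feasible
  pair, and the cost can be made arbitrarily small.
\<close>

lemma V1_eq_0_imp_eq:
  fixes L :: "complex^'n^'n^'b"
  assumes "\<alpha> > 0" "x \<in> psd_mats" "y \<in> psd_mats" "V1 \<alpha> L x y = 0"
  shows "x = y"
proof -
  have "x $ i $ j = y $ i $ j" for i j
  proof -
    define C where "C = (\<Sum>k\<in>UNIV. \<Sum>l\<in>UNIV. cmod (L $ k $ i $ l) + cmod (L $ k $ l $ j))"
    have C: "C \<ge> 0"
      by (auto simp: C_def intro!: sum_nonneg)
    have "cmod (x $ i $ j - y $ i $ j) \<le> 0 + \<epsilon>" if "\<epsilon> > 0" for \<epsilon>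
    proof -
      define K where "K = C + 1 / \<alpha>"
      have K: "K > 0"
        using C assms(1) by (simp add: K_def add_nonneg_pos)
      obtain u v where uv: "(u, v) \<in> V1_feasible L x y" "V1_cost \<alpha> (u, v) < \<epsilon> / K"
        using V1_near_optimal[OF assms(1-3) divide_pos_pos[OF \<open>\<epsilon> > 0\<close> K], of L] assms(4) by auto
      have "x - y = grad_adj L u + v"
        using uv(1) by (simp add: V1_feasible_def algebra_simps)
      then have "cmod (x $ i $ j - y $ i $ j) = cmod (grad_adj L u $ i $ j + v $ i $ j)"
        by (metis vector_add_component vector_minus_component)
      also have "\<dots> \<le> C * nuclear_norm (stack u) + nuclear_norm v"
        using cmod_grad_adj_entry_le[of L u i j] entry_le_nuclear_norm[of v i j]
        by (intro order_trans[OF norm_triangle_ineq] add_mono) (auto simp: C_def)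
      also have "\<dots> \<le> C * V1_cost \<alpha> (u, v) + 1 / \<alpha> * V1_cost \<alpha> (u, v)"
        using assms(1) C nuclear_norm_nonneg[of v] nuclear_norm_nonneg[of "stack u"]
        by (intro add_mono mult_left_mono) (auto simp: V1_cost_def field_simps)
      also have "\<dots> = K * V1_cost \<alpha> (u, v)"
        by (simp add: K_def algebra_simps)
      also have "\<dots> \<le> \<epsilon>"
        using uv(2) K by (simp add: field_simps)
      finally show ?thesis
        by simp
    qed
    then have "cmod (x $ i $ j - y $ i $ j) \<le> 0"
      by (rule field_le_epsilon)
    then show ?thesis
      by simp
  qed
  then show ?thesis
    by (simp add: vec_eq_iff)
qed

theorem theorem4:
  fixes L :: "complex^'n^'n^'b" and \<alpha> :: real
  assumes "\<alpha> > 0"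
    and "L \<in> herm_cols"
    and "{X \<in> herm_mats. grad L X = 0} \<subseteq> {X. \<exists>c::complex. X = mat c}"
  shows "Metric_space (psd_mats :: (complex^'n^'n) set) (V1 \<alpha> L)"
proof
  show "0 \<le> V1 \<alpha> L x y" for x y
    by (rule V1_nonneg[OF assms(1)])
  show "V1 \<alpha> L x y = V1 \<alpha> L y x" for x y
    by (intro antisym V1_commute_le assms(1))
  show "V1 \<alpha> L x y = 0 \<longleftrightarrow> x = y" if "x \<in> psd_mats" "y \<in> psd_mats" for x y
    using V1_eq_0_imp_eq[OF assms(1) that] V1_refl[OF assms(1)] that by blast
  show "V1 \<alpha> L x z \<le> V1 \<alpha> L x y + V1 \<alpha> L y z"
    if "x \<in> psd_mats" "y \<in> psd_mats" "z \<in> psd_mats" for x y z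
    by (rule V1_triangle[OF assms(1) that])
qed

end
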